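(* Let $d \ge 1$ and let $\tau : \mathbb{M}_d \to \mathbb{M}_d$ be a unital completely positive (UCP) map with a Choi-Kraus decomposition $\tau(X) = \sum_{i=1}^r L_i^* X L_i$ for all $X \in \mathbb{M}_d$, where $L_1,\dots,L_r \in \mathbb{M}_d$. Then the following are equivalent. (1) $\mathcal{P}(\tau) \subseteq \mathcal{M}_\tau$. (2) $\mathcal{P}(\tau) \subseteq \mathcal{M}_{\tau^\infty} := \bigcap_{k=1}^\infty \mathcal{M}_{\tau^k}$. (3) $\tau$ is peripherally automorphic. (4) For every $\lambda \in \mathbb{T}$, $X \in E_\lambda(\tau)$ implies $\tau(X^*X) = X^*X$. (5) For every $\lambda \in \mathbb{T}$ and $Y \in \mathbb{M}_d$, $Y \in E_\lambda(\tau)$ if and only if $Y L_i = \lambda L_i Y$ for every $1 \le i \le r$.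
   Context: $\mathbb{M}_d$ is the $C^*$-algebra of $d\times d$ complex matrices and $\mathbb{T} = \{z \in \mathbb{C} : |z| = 1\}$. For a UCP map $\tau$ on $\mathbb{M}_d$ and $\lambda\in\mathbb{C}$, $E_\lambda(\tau) := \{X \in \mathbb{M}_d : \tau(X) = \lambda X\}$. The peripheral space of $\tau$ is $\mathcal{P}(\tau) := \mathrm{span}\{X \in \mathbb{M}_d : \tau(X) = \lambda X \text{ for some } \lambda \in \mathbb{T}\}$. The product $\circ$ on $\mathcal{P}(\tau)$ is the bilinear product determined by $X \circ Y = \lim_{n\to\infty} (\lambda\mu)^{-n}\tau^n(XY)$ for $X \in E_\lambda(\tau)$, $Y \in E_\mu(\tau)$, $\lambda,\mu\in\mathbb{T}$ (it is known that these limits exist, that the product is well defined, and that $(\mathcal{P}(\tau),\circ)$ with the norm and adjoint of $\mathbb{M}_d$ is a $C^*$-algebra). The map $\tau$ is called peripherally automorphic if $X \circ Y = XY$ for all $X, Y \in \mathcal{P}(\tau)$. The multiplicative domain of a UCP map $\sigma$ on $\mathbb{M}_d$ is $\mathcal{M}_\sigma := \{X \in \mathbb{M}_d : \sigma(XY) = \sigma(X)\sigma(Y) \text{ and } \sigma(YX) = \sigma(Y)\sigma(X) \text{ for every } Y \in \mathbb{M}_d\}$; equivalently, $\mathcal{M}_\sigma=\{X\in\mathbb{M}_d: \sigma(XX^* )=\sigma(X)\sigma(X^* ) \text{ and } \sigma(X^*X)=\sigma(X^* )\sigma(X)\}$. *)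

theory Defs
  imports "HOL-Analysis.Analysis"
begin

text \<open>
  \<open>d \<times> d\<close> complex matrices are \<^typ>\<open>complex^'d^'d\<close> with \<open>d = CARD('d)\<close>, so \<open>d \<ge> 1\<close> is automatic. The
  library's span and linearity for complex vector spaces are obtained from the scalar
  multiplication below. Limits of matrices are taken in the standard topology of
  \<^typ>\<open>complex^'d^'d\<close>, which is that of any norm on this finite-dimensional space.
\<close>

type_synonym 'd cmat = "complex^'d^'d"

definition cscale :: "complex \<Rightarrow> 'd::finite cmat \<Rightarrow> 'd cmat"  (infixr \<open>*\<^sub>C\<close> 75)
  where "c *\<^sub>C A = map_matrix (\<lambda>a. c * a) A"

global_interpretation cmat: vector_space "cscale :: complex \<Rightarrow> 'd::finite cmat \<Rightarrow> 'd cmat"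
  by standard (simp_all add: cscale_def vec_eq_iff algebra_simps)

definition cadj :: "'d::finite cmat \<Rightarrow> 'd cmat"
  where "cadj A = transpose (map_matrix cnj A)"

definition cinner :: "complex^'d::finite \<Rightarrow> complex^'d \<Rightarrow> complex"
  where "cinner v w = (\<Sum>i\<in>UNIV. cnj (v $ i) * w $ i)"


subsection \<open>Unital completely positive maps\<close>

text \<open>
  A family \<open>A i j\<close> (\<open>i, j < k\<close>) of \<open>d \<times> d\<close> matrices is read as an element of \<open>M\<^sub>k(M\<^sub>d)\<close> acting on the
  \<open>k\<close>-fold direct sum of \<open>\<complex>\<^sup>d\<close>; positivity is that of this operator.
\<close>

definition block_positive :: "nat \<Rightarrow> (nat \<Rightarrow> nat \<Rightarrow> 'd::finite cmat) \<Rightarrow> bool"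
  where "block_positive k A \<longleftrightarrow>
    (\<forall>v :: nat \<Rightarrow> complex^'d. (\<Sum>i<k. \<Sum>j<k. cinner (v i) (A i j *v v j)) \<in> \<real>\<^sub>\<ge>\<^sub>0)"

definition completely_positive :: "('d::finite cmat \<Rightarrow> 'd cmat) \<Rightarrow> bool"
  where "completely_positive \<tau> \<longleftrightarrow>
    Vector_Spaces.linear (*\<^sub>C) (*\<^sub>C) \<tau> \<and>
    (\<forall>k A. block_positive k A \<longrightarrow> block_positive k (\<lambda>i j. \<tau> (A i j)))"

definition UCP :: "('d::finite cmat \<Rightarrow> 'd cmat) \<Rightarrow> bool"
  where "UCP \<tau> \<longleftrightarrow> completely_positive \<tau> \<and> \<tau> (mat 1) = mat 1"


subsection \<open>Multiplicative domain\<close>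

definition mult_domain :: "('d::finite cmat \<Rightarrow> 'd cmat) \<Rightarrow> 'd cmat set"
  where "mult_domain \<sigma> =
    {X. \<forall>Y. \<sigma> (X ** Y) = \<sigma> X ** \<sigma> Y \<and> \<sigma> (Y ** X) = \<sigma> Y ** \<sigma> X}"

definition mult_domain_infinity :: "('d::finite cmat \<Rightarrow> 'd cmat) \<Rightarrow> 'd cmat set"
  where "mult_domain_infinity \<tau> = (\<Inter>k\<in>{1..}. mult_domain (\<tau> ^^ k))"


subsection \<open>Peripheral space\<close>

abbreviation unit_circle :: "complex set"  (\<open>\<bbbT>\<close>)
  where "\<bbbT> \<equiv> {z. cmod z = 1}"

definition eigspace :: "('d::finite cmat \<Rightarrow> 'd cmat) \<Rightarrow> complex \<Rightarrow> 'd cmat set"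
  where "eigspace \<tau> \<alpha> = {X. \<tau> X = \<alpha> *\<^sub>C X}"

definition peripheral_space :: "('d::finite cmat \<Rightarrow> 'd cmat) \<Rightarrow> 'd cmat set"
  where "peripheral_space \<tau> = cmat.span {X. \<exists>\<alpha>\<in>\<bbbT>. \<tau> X = \<alpha> *\<^sub>C X}"


subsection \<open>Peripheral product\<close>

text \<open>
  The product is given on pairs of peripheral eigenvectors and extended bilinearly. To make the
  extension explicit, an element \<open>X\<close> of the peripheral space is split into its components
  \<open>peripheral_part \<tau> X \<alpha> \<in> eigspace \<tau> \<alpha>\<close>. The splitting is unique since eigenvectors for distinct
  eigenvalues are independent; see \<open>peripheral_decomp_ex1\<close> below.
\<close>

definition peripheral_decomp ::
    "('d::finite cmat \<Rightarrow> 'd cmat) \<Rightarrow> 'd cmat \<Rightarrow> (complex \<Rightarrow> 'd cmat) \<Rightarrow> bool"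
  where "peripheral_decomp \<tau> X f \<longleftrightarrow>
    (\<forall>\<alpha>\<in>\<bbbT>. f \<alpha> \<in> eigspace \<tau> \<alpha>) \<and> (\<forall>\<alpha>. \<alpha> \<notin> \<bbbT> \<longrightarrow> f \<alpha> = 0) \<and>
    finite {\<alpha>. f \<alpha> \<noteq> 0} \<and> X = (\<Sum>\<alpha> | f \<alpha> \<noteq> 0. f \<alpha>)"

definition peripheral_part ::
    "('d::finite cmat \<Rightarrow> 'd cmat) \<Rightarrow> 'd cmat \<Rightarrow> complex \<Rightarrow> 'd cmat"
  where "peripheral_part \<tau> X = (THE f. peripheral_decomp \<tau> X f)"

definition eigen_product ::
    "('d::finite cmat \<Rightarrow> 'd cmat) \<Rightarrow> complex \<Rightarrow> complex \<Rightarrow> 'd cmat \<Rightarrow> 'd cmat \<Rightarrow> 'd cmat"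
  where "eigen_product \<tau> \<alpha> \<beta> X Y =
    lim (\<lambda>n. inverse ((\<alpha> * \<beta>) ^ n) *\<^sub>C (\<tau> ^^ n) (X ** Y))"

definition peripheral_product ::
    "('d::finite cmat \<Rightarrow> 'd cmat) \<Rightarrow> 'd cmat \<Rightarrow> 'd cmat \<Rightarrow> 'd cmat"
  where "peripheral_product \<tau> X Y =
    (\<Sum>\<alpha> | peripheral_part \<tau> X \<alpha> \<noteq> 0. \<Sum>\<beta> | peripheral_part \<tau> Y \<beta> \<noteq> 0.
      eigen_product \<tau> \<alpha> \<beta> (peripheral_part \<tau> X \<alpha>) (peripheral_part \<tau> Y \<beta>))"

definition peripherally_automorphic :: "('d::finite cmat \<Rightarrow> 'd cmat) \<Rightarrow> bool"
  where "peripherally_automorphic \<tau> \<longleftrightarrow>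
    (\<forall>X\<in>peripheral_space \<tau>. \<forall>Y\<in>peripheral_space \<tau>. peripheral_product \<tau> X Y = X ** Y)"


subsection \<open>Well-definedness of the peripheral components\<close>

lemma eigspace_independent:
  assumes lin: "Vector_Spaces.linear (*\<^sub>C) (*\<^sub>C) \<tau>" and "finite S"
    and "\<And>\<alpha>. \<alpha> \<in> S \<Longrightarrow> f \<alpha> \<in> eigspace \<tau> \<alpha>" and "(\<Sum>\<alpha>\<in>S. f \<alpha>) = 0"
  shows "\<forall>\<alpha>\<in>S. f \<alpha> = 0"
  using assms(2-)
proof (induction S arbitrary: f rule: finite_induct)
  case empty
  then show ?case by simp
next
  case (insert a S)
  interpret t: Vector_Spaces.linear "(*\<^sub>C)" "(*\<^sub>C)" \<tau> by (rule lin)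
  define g where "g \<alpha> = (\<alpha> - a) *\<^sub>C f \<alpha>" for \<alpha>
  have eig: "\<tau> (f \<alpha>) = \<alpha> *\<^sub>C f \<alpha>" if "\<alpha> \<in> insert a S" for \<alpha>
    using insert.prems(1)[OF that] by (simp add: eigspace_def)
  have tot: "f a + sum f S = 0"
    using insert.prems(2) insert.hyps by simp
  have "\<tau> (f a + sum f S) = a *\<^sub>C f a + (\<Sum>\<alpha>\<in>S. \<alpha> *\<^sub>C f \<alpha>)"
    using eig by (simp add: t.add t.sum)
  then have "a *\<^sub>C f a + (\<Sum>\<alpha>\<in>S. \<alpha> *\<^sub>C f \<alpha>) = 0"
    by (simp add: tot t.zero)
  moreover have "a *\<^sub>C f a + a *\<^sub>C sum f S = 0"
    using tot by (metis cmat.scale_right_distrib cmat.scale_zero_right)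
  ultimately have "(\<Sum>\<alpha>\<in>S. \<alpha> *\<^sub>C f \<alpha>) - a *\<^sub>C sum f S = 0"
    by (metis add_left_cancel diff_self)
  then have "sum g S = 0"
    by (simp add: g_def cmat.scale_left_diff_distrib sum_subtractf cmat.scale_sum_right)
  moreover have "g \<alpha> \<in> eigspace \<tau> \<alpha>" if "\<alpha> \<in> S" for \<alpha>
    using eig[of \<alpha>] that by (simp add: eigspace_def g_def t.scale mult.commute)
  ultimately have "\<forall>\<alpha>\<in>S. g \<alpha> = 0" using insert.IH by blast
  then have "\<forall>\<alpha>\<in>S. f \<alpha> = 0" using insert.hyps by (auto simp: g_def)
  with tot show ?case by simp
qed

lemma peripheral_decomp_unique:
  assumes lin: "Vector_Spaces.linear (*\<^sub>C) (*\<^sub>C) \<tau>"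
    and f: "peripheral_decomp \<tau> X f" and g: "peripheral_decomp \<tau> X g"
  shows "f = g"
proof -
  interpret t: Vector_Spaces.linear "(*\<^sub>C)" "(*\<^sub>C)" \<tau> by (rule lin)
  define S where "S = {\<alpha>. f \<alpha> \<noteq> 0} \<union> {\<alpha>. g \<alpha> \<noteq> 0}"
  have fin: "finite S" using f g by (simp add: S_def peripheral_decomp_def)
  have "sum f S = X"
  proof -
    have "sum f S = (\<Sum>\<alpha> | f \<alpha> \<noteq> 0. f \<alpha>)"
      using fin by (intro sum.mono_neutral_right) (auto simp: S_def)
    then show ?thesis using f by (simp add: peripheral_decomp_def)
  qed
  moreover have "sum g S = X"
  proof -
    have "sum g S = (\<Sum>\<alpha> | g \<alpha> \<noteq> 0. g \<alpha>)"
      using fin by (intro sum.mono_neutral_right) (auto simp: S_def)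
    then show ?thesis using g by (simp add: peripheral_decomp_def)
  qed
  ultimately have "(\<Sum>\<alpha>\<in>S. f \<alpha> - g \<alpha>) = 0" by (simp add: sum_subtractf)
  moreover have "f \<alpha> - g \<alpha> \<in> eigspace \<tau> \<alpha>" for \<alpha>
  proof (cases "\<alpha> \<in> \<bbbT>")
    case True
    then have "f \<alpha> \<in> eigspace \<tau> \<alpha>" "g \<alpha> \<in> eigspace \<tau> \<alpha>"
      using f g by (simp_all add: peripheral_decomp_def)
    then show ?thesis
      by (simp add: eigspace_def t.diff cmat.scale_right_diff_distrib)
  next
    case False
    then have "f \<alpha> = 0" "g \<alpha> = 0" using f g by (simp_all add: peripheral_decomp_def)
    then show ?thesis by (simp add: eigspace_def t.zero)
  qed
  ultimately have eq: "\<forall>\<alpha>\<in>S. f \<alpha> - g \<alpha> = 0"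
    by (intro eigspace_independent[OF lin fin])
  show ?thesis
  proof
    fix \<alpha>
    show "f \<alpha> = g \<alpha>"
    proof (cases "\<alpha> \<in> S")
      case True
      with eq show ?thesis by (metis eq_iff_diff_eq_0)
    next
      case False
      then show ?thesis by (simp add: S_def)
    qed
  qed
qed

lemma peripheral_decomp_eigenvector:
  assumes lin: "Vector_Spaces.linear (*\<^sub>C) (*\<^sub>C) \<tau>"
    and "\<alpha> \<in> \<bbbT>" and "X \<in> eigspace \<tau> \<alpha>"
  shows "peripheral_decomp \<tau> X (\<lambda>\<beta>. if \<beta> = \<alpha> then X else 0)"
proof -
  interpret t: Vector_Spaces.linear "(*\<^sub>C)" "(*\<^sub>C)" \<tau> by (rule lin)
  have "{\<beta>. (if \<beta> = \<alpha> then X else 0) \<noteq> 0} = (if X = 0 then {} else {\<alpha>})" by auto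
  then show ?thesis
    using assms(2,3) by (auto simp: peripheral_decomp_def eigspace_def t.zero)
qed

lemma peripheral_decomp_ex1:
  assumes lin: "Vector_Spaces.linear (*\<^sub>C) (*\<^sub>C) \<tau>" and "X \<in> peripheral_space \<tau>"
  shows "\<exists>!f. peripheral_decomp \<tau> X f"
proof -
  interpret t: Vector_Spaces.linear "(*\<^sub>C)" "(*\<^sub>C)" \<tau> by (rule lin)
  have "\<exists>f. peripheral_decomp \<tau> X f"
    using assms(2) unfolding peripheral_space_def
  proof (induction rule: cmat.span_induct_alt)
    case base
    show ?case
      by (rule exI[of _ "\<lambda>_. 0"]) (simp add: peripheral_decomp_def eigspace_def t.zero)
  next
    case (step c x y)
    then obtain \<alpha> f where \<alpha>: "\<alpha> \<in> \<bbbT>" "\<tau> x = \<alpha> *\<^sub>C x" and f: "peripheral_decomp \<tau> y f"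
      by blast
    define h where "h = f(\<alpha> := c *\<^sub>C x + f \<alpha>)"
    let ?S = "insert \<alpha> {\<beta>. f \<beta> \<noteq> 0}"
    have fin: "finite ?S" using f by (simp add: peripheral_decomp_def)
    have sub: "{\<beta>. h \<beta> \<noteq> 0} \<subseteq> ?S" by (auto simp: h_def)
    have "f \<alpha> \<in> eigspace \<tau> \<alpha>" using f \<alpha>(1) unfolding peripheral_decomp_def by blast
    then have "h \<alpha> \<in> eigspace \<tau> \<alpha>"
      using \<alpha>(2)
      by (simp add: h_def eigspace_def t.add t.scale cmat.scale_right_distrib mult.commute)
    then have "\<forall>\<beta>\<in>\<bbbT>. h \<beta> \<in> eigspace \<tau> \<beta>"
      using f by (auto simp: peripheral_decomp_def h_def)
    moreover have "\<forall>\<beta>. \<beta> \<notin> \<bbbT> \<longrightarrow> h \<beta> = 0"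
      using f \<alpha>(1) by (auto simp: peripheral_decomp_def h_def)
    moreover have "finite {\<beta>. h \<beta> \<noteq> 0}" using fin sub by (rule rev_finite_subset)
    moreover have "c *\<^sub>C x + y = (\<Sum>\<beta> | h \<beta> \<noteq> 0. h \<beta>)"
    proof -
      have "(\<Sum>\<beta> | h \<beta> \<noteq> 0. h \<beta>) = sum h ?S"
        using fin sub by (intro sum.mono_neutral_left) auto
      also have "\<dots> = h \<alpha> + sum h (?S - {\<alpha>})" using fin by (intro sum.remove) auto
      also have "sum h (?S - {\<alpha>}) = sum f (?S - {\<alpha>})"
        by (intro sum.cong) (auto simp: h_def)
      also have "h \<alpha> + sum f (?S - {\<alpha>}) = c *\<^sub>C x + (f \<alpha> + sum f (?S - {\<alpha>}))"
        by (simp add: h_def add.assoc)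
      also have "f \<alpha> + sum f (?S - {\<alpha>}) = sum f ?S"
        using fin by (intro sum.remove[symmetric]) auto
      also have "sum f ?S = (\<Sum>\<beta> | f \<beta> \<noteq> 0. f \<beta>)"
        using fin by (intro sum.mono_neutral_right) auto
      also have "\<dots> = y" using f by (simp add: peripheral_decomp_def)
      finally show ?thesis by simp
    qed
    ultimately have "peripheral_decomp \<tau> (c *\<^sub>C x + y) h"
      by (simp add: peripheral_decomp_def)
    then show ?case by blast
  qed
  then show ?thesis by (metis peripheral_decomp_unique[OF lin])
qed

lemma peripheral_part_eigenvector:
  assumes "Vector_Spaces.linear (*\<^sub>C) (*\<^sub>C) \<tau>" and "\<alpha> \<in> \<bbbT>" and "X \<in> eigspace \<tau> \<alpha>"
  shows "peripheral_part \<tau> X = (\<lambda>\<beta>. if \<beta> = \<alpha> then X else 0)"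
  unfolding peripheral_part_def
proof (rule the_equality)
  show *: "peripheral_decomp \<tau> X (\<lambda>\<beta>. if \<beta> = \<alpha> then X else 0)"
    by (rule peripheral_decomp_eigenvector[OF assms])
  show "f = (\<lambda>\<beta>. if \<beta> = \<alpha> then X else 0)" if "peripheral_decomp \<tau> X f" for f
    by (rule peripheral_decomp_unique[OF assms(1) that *])
qed

lemma peripheral_product_eigenvectors:
  assumes lin: "Vector_Spaces.linear (*\<^sub>C) (*\<^sub>C) \<tau>"
    and X: "\<alpha> \<in> \<bbbT>" "X \<in> eigspace \<tau> \<alpha>" and Y: "\<beta> \<in> \<bbbT>" "Y \<in> eigspace \<tau> \<beta>"
  shows "peripheral_product \<tau> X Y = lim (\<lambda>n. inverse ((\<alpha> * \<beta>) ^ n) *\<^sub>C (\<tau> ^^ n) (X ** Y))"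
proof -
  interpret t: Vector_Spaces.linear "(*\<^sub>C)" "(*\<^sub>C)" \<tau> by (rule lin)
  have zero: "(\<tau> ^^ n) 0 = 0" for n by (induction n) (simp_all add: t.zero)
  have supp: "{\<nu>. (if \<nu> = \<kappa> then Z else 0) \<noteq> 0} = (if Z = 0 then {} else {\<kappa>})"
    for \<kappa> :: complex and Z :: "'a cmat" by auto
  show ?thesis
    unfolding peripheral_product_def
      peripheral_part_eigenvector[OF lin X] peripheral_part_eigenvector[OF lin Y] supp
    by (cases "X = 0"; cases "Y = 0") (simp_all add: eigen_product_def zero)
qed

end

theory Submission
  imports Defs
begin

text \<open>
  Everything rests on the identity
  \<open>\<tau>(X\<^sup>*X) - \<tau>(X)\<^sup>*\<tau>(X) = \<Sum>\<^sub>i (X L\<^sub>i - L\<^sub>i \<tau>(X))\<^sup>* (X L\<^sub>i - L\<^sub>i \<tau>(X))\<close>. For a peripheral eigenvector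
  \<open>X\<close> with eigenvalue \<open>\<lambda>\<close> the left side is \<open>\<tau>(X\<^sup>*X) - X\<^sup>*X\<close>, so it vanishes exactly when
  \<open>X L\<^sub>i = \<lambda> L\<^sub>i X\<close> for all \<open>i\<close>, and these commutation relations, for \<open>X\<close> and \<open>X\<^sup>*\<close>, give
  multiplicativity. In general the identity shows that \<open>\<tau>\<^sup>n(X\<^sup>*X)\<close> is an increasing bounded sequence,
  hence convergent; its limit \<open>X\<^sup>* \<circ> X\<close> is fixed by \<open>\<tau>\<close>, so \<open>X\<^sup>* \<circ> X = X\<^sup>*X\<close> forces
  \<open>\<tau>(X\<^sup>*X) = X\<^sup>*X\<close>.
\<close>

subsection \<open>Matrix algebra\<close>

lemma cscale_nth [simp]: "(c *\<^sub>C A) $ i $ j = c * A $ i $ j"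
  by (simp add: cscale_def)

lemma cadj_nth [simp]: "cadj A $ i $ j = cnj (A $ j $ i)"
  by (simp add: cadj_def transpose_def)

lemma cadj_cadj [simp]: "cadj (cadj A) = A"
  by (simp add: vec_eq_iff)

lemma cadj_mult: "cadj (A ** B) = cadj B ** cadj A"
  by (simp add: vec_eq_iff matrix_matrix_mult_def mult.commute)

lemma cadj_cscale: "cadj (c *\<^sub>C A) = cnj c *\<^sub>C cadj A"
  by (simp add: vec_eq_iff)

lemma cadj_diff: "cadj (A - B) = cadj A - cadj B"
  by (simp add: vec_eq_iff)

lemma cadj_sum: "cadj (\<Sum>i\<in>I. f i) = (\<Sum>i\<in>I. cadj (f i))"
  by (simp add: vec_eq_iff)

lemma cscale_mult_left: "(c *\<^sub>C A) ** B = c *\<^sub>C (A ** B)"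
  by (simp add: vec_eq_iff matrix_matrix_mult_def sum_distrib_left mult.assoc)

lemma cscale_mult_right: "A ** (c *\<^sub>C B) = c *\<^sub>C (A ** B)"
  by (simp add: vec_eq_iff matrix_matrix_mult_def sum_distrib_left mult.left_commute)

lemma matrix_diff_mult_left: "(A - B) ** C = A ** C - B ** (C :: 'd::finite cmat)"
  by (simp add: vec_eq_iff matrix_matrix_mult_def sum_subtractf left_diff_distrib)

lemma matrix_diff_mult_right: "C ** (A - B) = C ** A - C ** (B :: 'd::finite cmat)"
  by (simp add: vec_eq_iff matrix_matrix_mult_def sum_subtractf right_diff_distrib)

lemma matrix_add_mult_left: "(A + B) ** C = A ** C + B ** (C :: 'd::finite cmat)"
  by (simp add: vec_eq_iff matrix_matrix_mult_def sum.distrib distrib_right)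

lemma matrix_sum_mult_left: "(\<Sum>i\<in>I. f i) ** B = (\<Sum>i\<in>I. f i ** (B :: 'd::finite cmat))"
  by (induction I rule: infinite_finite_induct)
    (simp_all add: matrix_add_mult_left)

lemma matrix_sum_mult_right: "B ** (\<Sum>i\<in>I. f i) = (\<Sum>i\<in>I. B ** (f i :: 'd::finite cmat))"
  by (induction I rule: infinite_finite_induct)
    (simp_all add: matrix_add_ldistrib)

lemma matrix_sum_vector_mult: "(\<Sum>i\<in>I. f i) *v v = (\<Sum>i\<in>I. (f i :: 'd::finite cmat) *v v)"
  by (induction I rule: infinite_finite_induct)
    (simp_all add: matrix_vector_mult_add_rdistrib)

lemma cinner_add_right: "cinner v (u + w) = cinner v u + cinner v w"
  by (simp add: cinner_def algebra_simps sum.distrib)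

lemma cinner_add_left: "cinner (u + w) v = cinner u v + cinner w v"
  by (simp add: cinner_def algebra_simps sum.distrib)

lemma cinner_diff_right: "cinner v (u - w) = cinner v u - cinner v w"
  by (simp add: cinner_def algebra_simps sum_subtractf)

lemma cinner_vmult_right: "cinner v (c *s w) = c * cinner v w"
  by (simp add: cinner_def sum_distrib_left mult.left_commute)

lemma cinner_vmult_left: "cinner (c *s v) w = cnj c * cinner v w"
  by (simp add: cinner_def sum_distrib_left mult.assoc)

lemma cinner_sum_right: "cinner v (\<Sum>i\<in>I. f i) = (\<Sum>i\<in>I. cinner v (f i))"
  by (induction I rule: infinite_finite_induct)
    (simp_all add: cinner_add_right, simp_all add: cinner_def)

lemma cinner_self: "cinner v v = of_real ((norm v)\<^sup>2)"
proof -
  have "cinner v v = (\<Sum>i\<in>UNIV. of_real ((cmod (v $ i))\<^sup>2))"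
    unfolding cinner_def by (intro sum.cong refl) (metis complex_norm_square mult.commute)
  then show ?thesis
    by (simp add: norm_vec_def L2_set_def sum_nonneg del: of_real_power)
qed

lemma cinner_cadj: "cinner v (cadj A *v w) = cinner (A *v v) w"
proof -
  have "cinner v (cadj A *v w) = (\<Sum>i\<in>UNIV. \<Sum>j\<in>UNIV. cnj (v $ i) * (cnj (A $ j $ i) * w $ j))"
    by (simp add: cinner_def matrix_vector_mult_def sum_distrib_left)
  also have "\<dots> = (\<Sum>j\<in>UNIV. \<Sum>i\<in>UNIV. cnj (v $ i) * (cnj (A $ j $ i) * w $ j))"
    by (rule sum.swap)
  also have "\<dots> = cinner (A *v v) w"
    by (simp add: cinner_def matrix_vector_mult_def sum_distrib_left sum_distrib_right mult_ac)
  finally show ?thesis .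
qed

lemma matrix_nth_cinner: "A $ i $ j = cinner (axis i 1) (A *v axis j 1)"
  by (simp add: cinner_def matrix_vector_mult_def axis_def if_distrib[of cnj]
      if_distrib[of "\<lambda>x. x * _"] if_distrib[of "\<lambda>x. _ * x"] cong: if_cong)

text \<open>Complex polarization for a form conjugate-linear in its first argument. Differences
  appear as \<open>v + c *s w\<close>, so that additivity and the scalar rules expand all four terms
  alike.\<close>

lemma cinner_polarization:
  "4 * cinner v (A *v w) =
    cinner (v + w) (A *v (v + w)) - cinner (v + (-1) *s w) (A *v (v + (-1) *s w))
    + \<i> * cinner (v + (-\<i>) *s w) (A *v (v + (-\<i>) *s w))
    - \<i> * cinner (v + \<i> *s w) (A *v (v + \<i> *s w))"
  unfolding matrix_vector_right_distrib vector_scalar_commute cinner_add_left cinner_add_right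
    cinner_vmult_left cinner_vmult_right
  by (simp add: algebra_simps)

text \<open>Evaluated at a vector \<open>v\<close>, the quadratic form of the sum is the sum of the
  squared norms of \<open>C i *v v\<close>, so every term vanishes.\<close>

lemma sum_cadj_mult_eq_0:
  fixes C :: "'i \<Rightarrow> 'd::finite cmat"
  assumes "finite I" and "(\<Sum>i\<in>I. cadj (C i) ** C i) = 0" and "i \<in> I"
  shows "C i = 0"
proof -
  have "C i *v v = 0" for v
  proof -
    have "0 = cinner v ((\<Sum>i\<in>I. cadj (C i) ** C i) *v v)"
      using assms(2) by (simp add: cinner_def)
    also have "\<dots> = of_real (\<Sum>i\<in>I. (norm (C i *v v))\<^sup>2)"
      by (simp add: matrix_sum_vector_mult cinner_sum_right cinner_cadj cinner_self
          flip: matrix_vector_mul_assoc)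
    finally have "(\<Sum>i\<in>I. (norm (C i *v v))\<^sup>2) = 0"
      by (metis of_real_eq_0_iff)
    then show ?thesis
      using assms(1,3) by (simp add: sum_nonneg_eq_0_iff)
  qed
  then show ?thesis
    by (simp add: matrix_eq)
qed

subsection \<open>Bounded increasing sequences of matrices\<close>

text \<open>Membership in the nonnegative reals also demands that the form be real, which over the
  complex numbers includes self-adjointness.\<close>

definition psd :: "'d::finite cmat \<Rightarrow> bool"
  where "psd A \<longleftrightarrow> (\<forall>v. cinner v (A *v v) \<in> \<real>\<^sub>\<ge>\<^sub>0)"

lemma cinner_cscale_mat_1: "cinner v (c *\<^sub>C mat 1 *v v) = c * of_real ((norm v)\<^sup>2)"
proof -
  have "c *\<^sub>C mat 1 *v v = c *s v"
    by (simp add: vec_eq_iff matrix_vector_mult_def mat_def if_distrib[of "\<lambda>x. x * _"]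
        if_distrib[of "\<lambda>x. _ * x"] cong: if_cong)
  then show ?thesis
    by (simp add: cinner_vmult_right cinner_self)
qed

lemma psd_cadj_mult: "psd (cadj A ** A)"
  by (simp add: psd_def cinner_cadj cinner_self flip: matrix_vector_mul_assoc)

lemma psd_sum: "(\<And>i. i \<in> I \<Longrightarrow> psd (f i)) \<Longrightarrow> psd (\<Sum>i\<in>I. f i)"
  by (auto simp: psd_def matrix_sum_vector_mult cinner_sum_right complex_nonneg_Reals_iff
      intro!: sum_nonneg)

lemma psd_congruence:
  assumes "psd A" shows "psd (cadj B ** A ** B)"
  using assms by (simp add: psd_def cinner_cadj flip: matrix_vector_mul_assoc)

lemma cadj_mult_bounded: "\<exists>c. psd (of_real c *\<^sub>C mat 1 - cadj A ** A)"
proof -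
  have "linear ((*v) A)"
    by (rule linearI)
      (simp add: matrix_vector_right_distrib,
        simp add: vec_eq_iff matrix_vector_mult_def scaleR_sum_right)
  then obtain c where c: "\<And>v. norm (A *v v) \<le> c * norm v"
    using linear_bounded by blast
  have "(norm (A *v v))\<^sup>2 \<le> c\<^sup>2 * (norm v)\<^sup>2" for v
    using power_mono[OF c[of v], of 2] by (simp add: power_mult_distrib)
  then have "psd (of_real (c\<^sup>2) *\<^sub>C mat 1 - cadj A ** A)"
    by (simp add: psd_def matrix_vector_mult_diff_rdistrib cinner_diff_right cinner_cscale_mat_1
        cinner_cadj cinner_self complex_nonneg_Reals_iff
        flip: matrix_vector_mul_assoc of_real_mult of_real_power of_real_diff)
  then show ?thesis ..
qed

text \<open>Each quadratic form is a bounded increasing real sequence; polarization turns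
  convergence of the forms into convergence of the matrix entries.\<close>

lemma psd_increasing_convergent:
  fixes B :: "nat \<Rightarrow> 'd::finite cmat"
  assumes pos: "\<And>n. psd (B n)" and inc: "\<And>n. psd (B (Suc n) - B n)"
    and bdd: "\<And>n. psd (of_real c *\<^sub>C mat 1 - B n)"
  shows "convergent B"
proof -
  let ?q = "\<lambda>v n. cinner v (B n *v v)"
  have q: "convergent (?q v)" for v
  proof -
    have "Re (?q v n) \<le> Re (?q v (Suc n))" for n
      using inc[of n]
      by (simp add: psd_def matrix_vector_mult_diff_rdistrib cinner_diff_right
          complex_nonneg_Reals_iff)
    then have "incseq (\<lambda>n. Re (?q v n))"
      by (rule incseq_SucI)
    moreover have "Re (?q v n) \<le> c * (norm v)\<^sup>2" for n
      using bdd[of n]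
      by (simp add: psd_def matrix_vector_mult_diff_rdistrib cinner_diff_right
          cinner_cscale_mat_1 complex_nonneg_Reals_iff flip: of_real_mult of_real_power)
    ultimately obtain l where "(\<lambda>n. Re (?q v n)) \<longlonglongrightarrow> l"
      using incseq_convergent by blast
    then have "(\<lambda>n. of_real (Re (?q v n))) \<longlonglongrightarrow> complex_of_real l"
      by (rule tendsto_of_real)
    \<comment> \<open>Positivity of \<open>B n\<close> makes the form real, so nothing is lost by
      passing to real parts.\<close>
    moreover have "of_real (Re (?q v n)) = ?q v n" for n
      using pos[of n] by (simp add: psd_def complex_nonneg_Reals_iff complex_eq_iff)
    ultimately show ?thesis
      by (auto simp: convergent_def)
  qed
  have "convergent (\<lambda>n. B n $ i $ j)" for i j
  proof -
    have "convergent (\<lambda>n. 4 * cinner (axis i 1) (B n *v axis j 1))"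
      unfolding cinner_polarization
      by (intro convergent_add convergent_diff convergent_mult convergent_const q)
    then show ?thesis
      by (subst matrix_nth_cinner, subst (asm) convergent_mult_const_iff) simp_all
  qed
  then obtain l where "(\<lambda>n. B n $ i $ j) \<longlonglongrightarrow> l i j" for i j
    unfolding convergent_def by metis
  then have "B \<longlonglongrightarrow> (\<chi> i j. l i j)"
    by (intro vec_tendstoI) simp
  then show ?thesis
    by (rule convergentI)
qed

subsection \<open>Unital Kraus maps\<close>

text \<open>The peripheral space is a span, so inclusion in a multiplicative domain need only be
  checked on peripheral eigenvectors.\<close>

lemma subspace_mult_domain:
  assumes "Vector_Spaces.linear (*\<^sub>C) (*\<^sub>C) \<sigma>"
  shows "cmat.subspace (mult_domain \<sigma>)"
proof -
  interpret s: Vector_Spaces.linear "(*\<^sub>C)" "(*\<^sub>C)" \<sigma> by (rule assms)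
  show ?thesis
    by (rule cmat.subspaceI)
      (simp_all add: mult_domain_def s.zero s.add s.scale matrix_add_ldistrib matrix_add_mult_left
        cscale_mult_left cscale_mult_right)
qed

locale unital_kraus =
  fixes \<tau> :: "'d::finite cmat \<Rightarrow> 'd cmat" and r :: nat and L :: "nat \<Rightarrow> 'd cmat"
  assumes kraus: "\<tau> X = (\<Sum>i=1..r. cadj (L i) ** X ** L i)"
    and unital: "\<tau> (mat 1) = mat 1"
begin

lemma linear: "Vector_Spaces.linear (*\<^sub>C) (*\<^sub>C) \<tau>"
  unfolding Vector_Spaces.linear_iff
  using cmat.vector_space_axioms
  by (simp_all add: kraus matrix_add_ldistrib matrix_add_mult_left sum.distrib
      cscale_mult_left cscale_mult_right cmat.scale_sum_right)

sublocale lin: Vector_Spaces.linear "(*\<^sub>C)" "(*\<^sub>C)" \<tau>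
  by (rule linear)

lemma sum_kraus: "(\<Sum>i=1..r. cadj (L i) ** L i) = mat 1"
  using unital by (simp add: kraus)

lemma cadj_map: "\<tau> (cadj X) = cadj (\<tau> X)"
  by (simp add: kraus cadj_sum cadj_mult matrix_mul_assoc)

lemma eigspace_cadj: "X \<in> eigspace \<tau> \<alpha> \<Longrightarrow> cadj X \<in> eigspace \<tau> (cnj \<alpha>)"
  by (simp add: eigspace_def cadj_map cadj_cscale)

section \<open>The Schwarz defect and the commutation relations\<close>

lemma map_cadj_mult_diff:
  "\<tau> (cadj X ** X) - cadj (\<tau> X) ** \<tau> X =
    (\<Sum>i=1..r. cadj (X ** L i - L i ** \<tau> X) ** (X ** L i - L i ** \<tau> X))"
proof -
  \<comment> \<open>Both mixed sums equal \<open>cadj (\<tau> X) ** \<tau> X\<close> by the Kraus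
    form; the last sum equals it too, by unitality. One copy survives, with a minus sign.\<close>
  have "(\<Sum>i=1..r. cadj (X ** L i - L i ** \<tau> X) ** (X ** L i - L i ** \<tau> X)) =
      (\<Sum>i=1..r. cadj (L i) ** (cadj X ** X) ** L i)
      - (\<Sum>i=1..r. cadj (L i) ** cadj X ** L i) ** \<tau> X
      - cadj (\<tau> X) ** (\<Sum>i=1..r. cadj (L i) ** X ** L i)
      + cadj (\<tau> X) ** (\<Sum>i=1..r. cadj (L i) ** L i) ** \<tau> X"
    unfolding matrix_sum_mult_left matrix_sum_mult_right
    by (simp add: cadj_diff cadj_mult matrix_diff_mult_left matrix_diff_mult_right
        matrix_mul_assoc sum_subtractf sum.distrib)
  then show ?thesis
    by (simp only: kraus[symmetric] sum_kraus cadj_map) simp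
qed

lemma map_cadj_mult_eigvec_diff:
  assumes "\<alpha> \<in> \<bbbT>" and "X \<in> eigspace \<tau> \<alpha>"
  shows "\<tau> (cadj X ** X) - cadj X ** X =
    (\<Sum>i=1..r. cadj (X ** L i - \<alpha> *\<^sub>C (L i ** X)) ** (X ** L i - \<alpha> *\<^sub>C (L i ** X)))"
proof -
  have "cnj \<alpha> * \<alpha> = 1"
    using assms(1) complex_norm_square[of \<alpha>] by (simp add: mult.commute)
  moreover have "\<tau> X = \<alpha> *\<^sub>C X"
    using assms(2) by (simp add: eigspace_def)
  ultimately show ?thesis
    using map_cadj_mult_diff[of X]
    by (simp add: cadj_cscale cscale_mult_left cscale_mult_right mult.commute)
qed

text \<open>Forwards, the defect is a vanishing sum of squares. Backwards, multiplying the relations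
  by \<open>cadj (L i)\<close> and summing gives the eigenvalue equation by unitality; the defect
  then vanishes term by term.\<close>

lemma eigvec_iff_commute:
  assumes "\<alpha> \<in> \<bbbT>"
  shows "X \<in> eigspace \<tau> \<alpha> \<and> \<tau> (cadj X ** X) = cadj X ** X \<longleftrightarrow>
    (\<forall>i\<in>{1..r}. X ** L i = \<alpha> *\<^sub>C (L i ** X))"
proof (intro iffI ballI)
  fix i assume X: "X \<in> eigspace \<tau> \<alpha> \<and> \<tau> (cadj X ** X) = cadj X ** X" and i: "i \<in> {1..r}"
  then have "X ** L i - \<alpha> *\<^sub>C (L i ** X) = 0"
    using map_cadj_mult_eigvec_diff[OF assms, of X]
    by (intro sum_cadj_mult_eq_0[where I = "{1..r}" and C = "\<lambda>i. X ** L i - \<alpha> *\<^sub>C (L i ** X)"])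
      auto
  then show "X ** L i = \<alpha> *\<^sub>C (L i ** X)"
    by simp
next
  assume comm: "\<forall>i\<in>{1..r}. X ** L i = \<alpha> *\<^sub>C (L i ** X)"
  have "\<tau> X = (\<Sum>i=1..r. cadj (L i) ** (X ** L i))"
    by (simp add: kraus matrix_mul_assoc)
  also have "\<dots> = (\<Sum>i=1..r. \<alpha> *\<^sub>C (cadj (L i) ** L i ** X))"
    using comm by (intro sum.cong) (simp_all add: cscale_mult_right matrix_mul_assoc)
  also have "\<dots> = \<alpha> *\<^sub>C X"
    by (simp only: sum_kraus matrix_mul_lid flip: cmat.scale_sum_right matrix_sum_mult_left)
  finally have X: "X \<in> eigspace \<tau> \<alpha>"
    by (simp add: eigspace_def)
  have "\<tau> (cadj X ** X) - cadj X ** X = 0"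
    unfolding map_cadj_mult_eigvec_diff[OF assms X] using comm by (intro sum.neutral) simp
  with X show "X \<in> eigspace \<tau> \<alpha> \<and> \<tau> (cadj X ** X) = cadj X ** X"
    by simp
qed

lemma map_mult_commute:
  assumes "\<forall>i\<in>{1..r}. X ** L i = \<alpha> *\<^sub>C (L i ** X)"
  shows "\<tau> (Y ** X) = \<alpha> *\<^sub>C (\<tau> Y ** X)"
proof -
  have "\<tau> (Y ** X) = (\<Sum>i=1..r. cadj (L i) ** Y ** (X ** L i))"
    by (simp add: kraus matrix_mul_assoc)
  also have "\<dots> = (\<Sum>i=1..r. \<alpha> *\<^sub>C (cadj (L i) ** Y ** L i ** X))"
    using assms by (intro sum.cong) (simp_all add: cscale_mult_right matrix_mul_assoc)
  finally show ?thesis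
    by (simp add: kraus cmat.scale_sum_right matrix_sum_mult_left)
qed

text \<open>The relations for \<open>X\<close> let it be pulled out on the right of
  \<open>\<tau>\<close>. Those for \<open>cadj X\<close> do the same, and taking adjoints turns this
  into pulling out \<open>X\<close> on the left.\<close>

lemma mult_domain_commute:
  assumes X: "X \<in> eigspace \<tau> \<alpha>"
    and comm: "\<forall>i\<in>{1..r}. X ** L i = \<alpha> *\<^sub>C (L i ** X)"
      "\<forall>i\<in>{1..r}. cadj X ** L i = cnj \<alpha> *\<^sub>C (L i ** cadj X)"
  shows "X \<in> mult_domain \<tau>"
proof -
  have "\<tau> (Y ** X) = \<tau> Y ** \<tau> X" for Y
    using X map_mult_commute[OF comm(1)] by (simp add: eigspace_def cscale_mult_right)
  moreover have "\<tau> (X ** Y) = \<tau> X ** \<tau> Y" for Y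
  proof -
    have "\<tau> (X ** Y) = cadj (\<tau> (cadj Y ** cadj X))"
      by (simp add: cadj_mult flip: cadj_map)
    also have "\<dots> = \<alpha> *\<^sub>C (X ** \<tau> Y)"
      using map_mult_commute[OF comm(2)] by (simp add: cadj_cscale cadj_mult cadj_map)
    finally show ?thesis
      using X by (simp add: eigspace_def cscale_mult_left)
  qed
  ultimately show ?thesis
    by (simp add: mult_domain_def)
qed

section \<open>Powers of the map and the peripheral product\<close>

lemma peripheral_spaceI: "\<alpha> \<in> \<bbbT> \<Longrightarrow> X \<in> eigspace \<tau> \<alpha> \<Longrightarrow> X \<in> peripheral_space \<tau>"
  unfolding peripheral_space_def by (intro cmat.span_base) (auto simp: eigspace_def)

lemma linear_funpow: "Vector_Spaces.linear (*\<^sub>C) (*\<^sub>C) (\<tau> ^^ n)"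
proof (induction n)
  case 0
  show ?case by (simp add: id_def cmat.linear_ident)
next
  case (Suc n)
  then show ?case
    using linear by (auto simp: Vector_Spaces.linear_iff)
qed

lemma funpow_eigvec: "X \<in> eigspace \<tau> \<alpha> \<Longrightarrow> (\<tau> ^^ n) X = \<alpha> ^ n *\<^sub>C X"
  by (induction n) (simp_all add: eigspace_def lin.scale mult.commute)

text \<open>The image of an eigenvector is a multiple of it and so stays in the multiplicative
  domain; multiplicativity can therefore be applied again at each iteration.\<close>

lemma funpow_mult_domain_eigvec:
  assumes "X \<in> eigspace \<tau> \<alpha>" and "X \<in> mult_domain \<tau>"
  shows "X \<in> mult_domain (\<tau> ^^ n)"
proof -
  have "(\<tau> ^^ n) (X ** Y) = \<alpha> ^ n *\<^sub>C (X ** (\<tau> ^^ n) Y) \<and>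
      (\<tau> ^^ n) (Y ** X) = \<alpha> ^ n *\<^sub>C ((\<tau> ^^ n) Y ** X)" for Y
    using assms
    by (induction n)
      (simp_all add: mult_domain_def eigspace_def lin.scale cscale_mult_left cscale_mult_right
        mult.commute)
  then show ?thesis
    by (simp add: mult_domain_def funpow_eigvec[OF assms(1)] cscale_mult_left cscale_mult_right)
qed

lemma peripheral_space_subset_mult_domainI:
  assumes "Vector_Spaces.linear (*\<^sub>C) (*\<^sub>C) \<sigma>"
    and "\<And>\<alpha> X. \<alpha> \<in> \<bbbT> \<Longrightarrow> X \<in> eigspace \<tau> \<alpha> \<Longrightarrow> X \<in> mult_domain \<sigma>"
  shows "peripheral_space \<tau> \<subseteq> mult_domain \<sigma>"
  unfolding peripheral_space_def
  using assms by (intro cmat.span_minimal subspace_mult_domain) (auto simp: eigspace_def)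

text \<open>Multiplicativity makes the product of two peripheral eigenvectors an eigenvector for the
  product of the eigenvalues. The sequence defining the peripheral product is then constant, and
  bilinearity does the rest.\<close>

lemma peripheral_product_eq_mult:
  assumes sub: "peripheral_space \<tau> \<subseteq> mult_domain \<tau>"
    and XY: "X \<in> peripheral_space \<tau>" "Y \<in> peripheral_space \<tau>"
  shows "peripheral_product \<tau> X Y = X ** Y"
proof -
  have decomp: "peripheral_decomp \<tau> Z (peripheral_part \<tau> Z)" if "Z \<in> peripheral_space \<tau>" for Z
    unfolding peripheral_part_def by (rule theI'[OF peripheral_decomp_ex1[OF linear that]])
  have eig: "eigen_product \<tau> \<alpha> \<beta> x y = x ** y"
    if "\<alpha> \<in> \<bbbT>" "\<beta> \<in> \<bbbT>" "x \<in> eigspace \<tau> \<alpha>" "y \<in> eigspace \<tau> \<beta>" for \<alpha> \<beta> x y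
  proof -
    have "x \<in> mult_domain \<tau>"
      using that sub peripheral_spaceI by blast
    then have "x ** y \<in> eigspace \<tau> (\<alpha> * \<beta>)"
      using that
      by (simp add: mult_domain_def eigspace_def cscale_mult_left cscale_mult_right mult.commute)
    moreover have "\<alpha> * \<beta> \<noteq> 0"
      using that by auto
    ultimately have "inverse ((\<alpha> * \<beta>) ^ n) *\<^sub>C (\<tau> ^^ n) (x ** y) = x ** y" for n
      by (simp add: funpow_eigvec del: mult_eq_0_iff)
    then show ?thesis
      by (simp add: eigen_product_def)
  qed
  let ?f = "peripheral_part \<tau> X" and ?g = "peripheral_part \<tau> Y"
  have mem: "\<alpha> \<in> \<bbbT>" "peripheral_part \<tau> Z \<alpha> \<in> eigspace \<tau> \<alpha>"
    if "peripheral_part \<tau> Z \<alpha> \<noteq> 0" "Z \<in> peripheral_space \<tau>" for Z \<alpha>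
  proof -
    show "\<alpha> \<in> \<bbbT>"
      using decomp[OF that(2)] that(1) unfolding peripheral_decomp_def by blast
    then show "peripheral_part \<tau> Z \<alpha> \<in> eigspace \<tau> \<alpha>"
      using decomp[OF that(2)] unfolding peripheral_decomp_def by blast
  qed
  have "peripheral_product \<tau> X Y = (\<Sum>\<alpha> | ?f \<alpha> \<noteq> 0. \<Sum>\<beta> | ?g \<beta> \<noteq> 0. ?f \<alpha> ** ?g \<beta>)"
    unfolding peripheral_product_def using mem XY by (intro sum.cong refl eig) simp_all
  also have "\<dots> = (\<Sum>\<alpha> | ?f \<alpha> \<noteq> 0. ?f \<alpha>) ** (\<Sum>\<beta> | ?g \<beta> \<noteq> 0. ?g \<beta>)"
    unfolding matrix_sum_mult_left by (simp add: matrix_sum_mult_right)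
  also have "\<dots> = X ** Y"
    using decomp[OF XY(1)] decomp[OF XY(2)] by (simp add: peripheral_decomp_def)
  finally show ?thesis .
qed

section \<open>Convergence of the iterates and fixed points\<close>

lemma psd_funpow: "psd A \<Longrightarrow> psd ((\<tau> ^^ n) A)"
  by (induction n) (simp_all add: kraus psd_sum psd_congruence)

text \<open>Convergence must be known before \<open>lim\<close> in the peripheral product can be
  used as a limit. The iterates increase because the defect is positive, and are bounded because
  powers of \<open>\<tau>\<close> fix the identity.\<close>

lemma convergent_funpow_cadj_mult:
  assumes "\<alpha> \<in> \<bbbT>" and "X \<in> eigspace \<tau> \<alpha>"
  shows "convergent (\<lambda>n. (\<tau> ^^ n) (cadj X ** X))"
proof -
  interpret pow: Vector_Spaces.linear "(*\<^sub>C)" "(*\<^sub>C)" "\<tau> ^^ n" for n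
    by (rule linear_funpow)
  obtain c where c: "psd (of_real c *\<^sub>C mat 1 - cadj X ** X)"
    using cadj_mult_bounded by blast
  have mat_1: "(\<tau> ^^ n) (mat 1) = mat 1" for n
    by (induction n) (simp_all add: unital)
  show ?thesis
  proof (rule psd_increasing_convergent)
    show "psd ((\<tau> ^^ n) (cadj X ** X))" for n
      by (intro psd_funpow psd_cadj_mult)
    have "psd (\<tau> (cadj X ** X) - cadj X ** X)"
      unfolding map_cadj_mult_eigvec_diff[OF assms] by (intro psd_sum psd_cadj_mult)
    \<comment> \<open>The difference of consecutive iterates is \<open>\<tau> ^^ n\<close> applied
      to the defect.\<close>
    then show "psd ((\<tau> ^^ Suc n) (cadj X ** X) - (\<tau> ^^ n) (cadj X ** X))" for n
      using psd_funpow[of "\<tau> (cadj X ** X) - cadj X ** X" n] by (simp add: pow.diff funpow_swap1)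
    show "psd (of_real c *\<^sub>C mat 1 - (\<tau> ^^ n) (cadj X ** X))" for n
      using psd_funpow[OF c, of n] by (simp add: pow.diff pow.scale mat_1)
  qed
qed

lemma continuous_map: "isCont \<tau> X"
proof -
  \<comment> \<open>Restricting to real scalars gives real linearity, from which continuity follows
    in finite dimension.\<close>
  have "of_real a *\<^sub>C X = a *\<^sub>R X" for a and X :: "'d cmat"
    by (simp add: vec_eq_iff scaleR_conv_of_real[where 'a = complex])
  then have "linear \<tau>"
    by (intro linearI) (metis lin.add, metis lin.scale)
  then show ?thesis
    by (simp add: linear_continuous_at linear_conv_bounded_linear)
qed

lemma fixed_of_peripherally_automorphic:
  assumes "peripherally_automorphic \<tau>" and X: "\<alpha> \<in> \<bbbT>" "X \<in> eigspace \<tau> \<alpha>"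
  shows "\<tau> (cadj X ** X) = cadj X ** X"
proof -
  let ?B = "\<lambda>n. (\<tau> ^^ n) (cadj X ** X)"
  have X': "cnj \<alpha> \<in> \<bbbT>" "cadj X \<in> eigspace \<tau> (cnj \<alpha>)"
    using X eigspace_cadj by auto
  \<comment> \<open>The eigenvalues of \<open>cadj X\<close> and \<open>X\<close> cancel, so the
    normalizing factors in the peripheral product are all 1.\<close>
  have "cnj \<alpha> * \<alpha> = 1"
    using X(1) complex_norm_square[of \<alpha>] by (simp add: mult.commute)
  then have "lim ?B = peripheral_product \<tau> (cadj X) X"
    using peripheral_product_eigenvectors[OF linear X' X] by simp
  also have "\<dots> = cadj X ** X"
    using assms(1) peripheral_spaceI[OF X] peripheral_spaceI[OF X']
    by (simp add: peripherally_automorphic_def)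
  finally have B: "?B \<longlonglongrightarrow> cadj X ** X"
    using convergent_funpow_cadj_mult[OF X] by (simp add: convergent_LIMSEQ_iff)
  then have "(\<lambda>n. \<tau> (?B n)) \<longlonglongrightarrow> \<tau> (cadj X ** X)"
    by (rule isCont_tendsto_compose[OF continuous_map])
  \<comment> \<open>Applying \<open>\<tau>\<close> only shifts the sequence of iterates by one
    index.\<close>
  moreover have "(\<lambda>n. \<tau> (?B n)) \<longlonglongrightarrow> cadj X ** X"
    using LIMSEQ_Suc[OF B] by simp
  ultimately show ?thesis
    by (rule LIMSEQ_unique)
qed

end

theorem theorem2p6:
  fixes \<tau> :: "complex^'d::finite^'d \<Rightarrow> complex^'d^'d"
    and r :: nat and L :: "nat \<Rightarrow> complex^'d^'d"
  assumes ucp: "UCP \<tau>"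
    and kraus: "\<And>X. \<tau> X = (\<Sum>i=1..r. cadj (L i) ** X ** L i)"
  shows
    "(peripheral_space \<tau> \<subseteq> mult_domain \<tau> \<longleftrightarrow>
        peripheral_space \<tau> \<subseteq> mult_domain_infinity \<tau>) \<and>
     (peripheral_space \<tau> \<subseteq> mult_domain_infinity \<tau> \<longleftrightarrow>
        peripherally_automorphic \<tau>) \<and>
     (peripherally_automorphic \<tau> \<longleftrightarrow>
        (\<forall>\<alpha>\<in>\<bbbT>. \<forall>X. X \<in> eigspace \<tau> \<alpha> \<longrightarrow> \<tau> (cadj X ** X) = cadj X ** X)) \<and>
     ((\<forall>\<alpha>\<in>\<bbbT>. \<forall>X. X \<in> eigspace \<tau> \<alpha> \<longrightarrow> \<tau> (cadj X ** X) = cadj X ** X) \<longleftrightarrow>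
        (\<forall>\<alpha>\<in>\<bbbT>. \<forall>Y. Y \<in> eigspace \<tau> \<alpha> \<longleftrightarrow>
            (\<forall>i\<in>{1..r}. Y ** L i = \<alpha> *\<^sub>C (L i ** Y))))"
proof -
  interpret unital_kraus \<tau> r L
    using ucp kraus by unfold_locales (simp_all add: UCP_def)
  let ?P1 = "peripheral_space \<tau> \<subseteq> mult_domain \<tau>"
  let ?P2 = "peripheral_space \<tau> \<subseteq> mult_domain_infinity \<tau>"
  let ?P3 = "peripherally_automorphic \<tau>"
  let ?P4 = "\<forall>\<alpha>\<in>\<bbbT>. \<forall>X. X \<in> eigspace \<tau> \<alpha> \<longrightarrow> \<tau> (cadj X ** X) = cadj X ** X"
  let ?P5 = "\<forall>\<alpha>\<in>\<bbbT>. \<forall>Y. Y \<in> eigspace \<tau> \<alpha> \<longleftrightarrow> (\<forall>i\<in>{1..r}. Y ** L i = \<alpha> *\<^sub>C (L i ** Y))"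
  have "?P2" if ?P1
    unfolding mult_domain_infinity_def
    using that peripheral_spaceI funpow_mult_domain_eigvec
    by (intro INT_greatest peripheral_space_subset_mult_domainI linear_funpow) blast
  moreover have "?P1" if ?P2
  proof -
    have "mult_domain_infinity \<tau> \<subseteq> mult_domain (\<tau> ^^ 1)"
      unfolding mult_domain_infinity_def by (rule INT_lower) simp
    with that show ?thesis by simp
  qed
  moreover have "?P3" if ?P1
    using peripheral_product_eq_mult[OF that] by (simp add: peripherally_automorphic_def)
  moreover have "?P4" if ?P3
    using fixed_of_peripherally_automorphic[OF that] by blast
  \<comment> \<open>Under \<open>?P4\<close> the fixed-point conjunct of
    \<open>eigvec_iff_commute\<close> is automatic; under \<open>?P5\<close> membership yields the
    relations, and these return that conjunct.\<close>
  moreover have "?P4 \<longleftrightarrow> ?P5"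
    using eigvec_iff_commute by blast
  moreover have "?P1" if ?P5
  proof (rule peripheral_space_subset_mult_domainI[OF linear])
    fix \<alpha> X assume X: "\<alpha> \<in> \<bbbT>" "X \<in> eigspace \<tau> \<alpha>"
    \<comment> \<open>\<open>?P5\<close> is used twice, for \<open>X\<close> and for its adjoint at
      the conjugate eigenvalue, to obtain multiplicativity on both sides.\<close>
    then have "cnj \<alpha> \<in> \<bbbT>" "cadj X \<in> eigspace \<tau> (cnj \<alpha>)"
      using eigspace_cadj by auto
    with X that show "X \<in> mult_domain \<tau>"
      by (intro mult_domain_commute) blast+
  qed
  ultimately show ?thesis
    by argo
qed

end
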